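(* Assume the setting described in the context, with $h_l>0$ and $h_l\to 0$, and assume: (H1) $\mathbb{P}\{X\in\eta^{-1}(1/2)\}=0$. (H2) For $a=0,1$: i) $I_a$ is connected, and ii) $\mathbb{P}(X\in I_a)>0$. (H3) For $a=0,1$, $\mathbb{P}\big(\bigcup_{l_0}\bigcap_{l\ge l_0}\mathcal{I}_{a,l}\big)=1$, where $\mathcal{I}_{a,l}=\{I_a\subseteq\bigcup_{x\in\mathcal{X}_l\cap I_a}B(x,h_l/2)\}$. (H5) There exists $\delta_0>0$ such that, for $a=0,1$ and any $0<\delta<\delta_0$: i) $A_a^\delta$ is connected, and ii) $\mathbb{P}\big(\bigcup_{l_0}\bigcap_{l\ge l_0}\mathcal{A}_{a,l}^\delta\big)=1$, where $\mathcal{A}_{a,l}^\delta=\{A_a^\delta\subseteq\bigcup_{x\in\mathcal{X}_l\cap A_a^\delta}B(x,h_l/2)\}$. (H6) The distribution of $X$ has a density $f$ and there exists $\delta_1>0$ such that for all $0<\delta<\delta_1$ there is $\gamma=\gamma(\delta)>0$ such that, whenever $0<h<\delta$, $f(a)-f(b)>\gamma$ for all $a\in A_0^\delta\cup A_1^\delta$ and all $b\in B_0^h\cup B_1^h$. (H7) With $\hat f_l(u)=(\omega_d l h_l^d)^{-1}\sum_{i=1}^l\mathbb{I}_{B(u,h_l)}(X_i)$, for every $\varepsilon>0$, $\mathbb{P}\big(\bigcup_{l_0}\bigcap_{l\ge l_0}\{\sup_{u\in S}|\hat f_l(u)-f(u)|<\varepsilon\}\big)=1$. (H8) $Y^i=g^*(X^i)$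 for all $(X^i,Y^i)\in\mathcal{D}^n$; moreover, for some $\delta_2>0$ and for each $a=0,1$ there is a point $X_a^*$ among $X^1,\dots,X^n$ with $X_a^*\in A_a^{\delta_2}$. Then the labels $g_{n,l,r(i)}(\mathcal{X}_l)=\tilde Y_i$ assigned by the algorithm satisfy $$\lim_{l\to\infty}\frac1l\sum_{i=1}^l\mathbb{I}_{\{g_{n,l,r(i)}(\mathcal{X}_l)\ne Y_i\}}=\mathbb{P}\{g^*(X)\ne Y\}\quad\text{almost surely,}$$ and therefore, for the fixed realization $\mathcal{D}^n$, $$\lim_{l\to\infty}\mathbb{E}_{\mathcal{D}_l}\Big(\frac1l\sum_{i=1}^l\mathbb{I}_{\{g_{n,l,r(i)}(\mathcal{X}_l)\ne Y_i\}}\Big)-\mathbb{P}\{g^*(X)\ne Y\}=0,$$ where $\mathbb{E}_{\mathcal{D}_l}$ is expectation with respect to $\mathcal{D}_l$.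
   Context: **Setting.** $\mathbb{R}^d$ has the Euclidean norm; $B(x,r)$ is the open ball, $B(A,r)=\bigcup_{s\in A}B(s,r)$, $\omega_d$ is the Lebesgue measure of $B(0,1)$, $d(x,A)=\inf_{a\in A}\|x-a\|$, and for $\delta>0$, $A\ominus B(0,\delta)=\{x:B(x,\delta)\subset A\}$. $(X,Y)$ is a random pair in $S\times\{0,1\}$, where $S\subset\mathbb{R}^d$ is the support of $X$; $\eta(x)=\mathbb{E}(Y\mid X=x)$; $g^*(x)=\mathbb{I}_{\{\eta(x)\ge 1/2\}}$ is the Bayes rule. Set $I_0=\eta^{-1}([0,1/2))$, $I_1=\eta^{-1}((1/2,1])$ (subsets of $S$), and for $a=0,1$, $A_a^\delta=I_a\ominus B(0,\delta)$; $B_0^h=I_0\cap B(I_1,h)$, $B_1^h=I_1\cap B(I_0,h)$. $\mathcal{D}^n=\{(X^1,Y^1),\dots,(X^n,Y^n)\}$ is a fixed realization (training sample, $n$ fixed) of identically distributed, not necessarily independent, copies of $(X,Y)$; $\mathcal{X}^n=\{X^1,\dots,X^n\}$. Since $X\in I_0\cup I_1$ almost surely under (H1), it is assumed that no point of $\mathcal{X}^n$ lies in $\eta^{-1}(1/2)$. $(X_1,Y_1),(X_2,Y_2),\dots$ are iid copies of $(X,Y)$; $\mathcal{D}_l=\{(X_1,Y_1),\dots,(X_l,Y_l)\}$, and $\mathcal{X}_l=\{X_1,\dots,X_l\}$ is observed while the labels $Y_1,\dots,Y_l$ are not. $(h_l)$ is a deterministic sequence of positive bandwidths. **Algorithm.**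 Input $\mathcal{D}^n,\mathcal{X}_l,h_l$. Start with $\mathcal{Z}_0=\mathcal{X}^n$, $\mathcal{U}_0=\mathcal{X}_l$, $\mathcal{T}_0=\mathcal{D}^n$. At step $j=1,\dots,l$: let $\mathcal{U}_{j-1}(h_l)=\{x\in\mathcal{U}_{j-1}: d(x,\mathcal{Z}_{j-1})<h_l\}$ (if this is empty, the algorithm stops). For $X_i\in\mathcal{U}_{j-1}(h_l)$ let $\hat\eta_{j-1}(X_i)$ be the average of the labels of all labelled points of $\mathcal{T}_{j-1}$ (true labels $Y^r$ for points of $\mathcal{D}^n$, assigned labels $\tilde Y_r$ for points of $\mathcal{X}_l$ already labelled) whose location lies in $B(X_i,h_l)$. Choose $X_{i_j}$ maximizing $\max\{\hat\eta_{j-1}(X_i),1-\hat\eta_{j-1}(X_i)\}$ over $X_i\in\mathcal{U}_{j-1}(h_l)$; if there are several maximizers, choose among them one that maximizes $\#\{\mathcal{X}_l\cap B(X_i,h_l)\}$. Assign the label $\tilde Y_{i_j}=\mathbb{I}_{\{\hat\eta_{j-1}(X_{i_j})\ge 1/2\}}$, and set $\mathcal{Z}_j=\mathcal{Z}_{j-1}\cup\{X_{i_j}\}$, $\mathcal{U}_j=\mathcal{U}_{j-1}\setminus\{X_{i_j}\}$, $\mathcal{T}_j=\mathcal{T}_{j-1}\cup\{(X_{i_j},\tilde Y_{i_j})\}$. Here $r(i)$ denotes the step at which $X_i$ is labelled and $g_{n,l,r(i)}(\mathcal{X}_l)=\tilde Y_i$ the label it receives. (If some points are never labelled, their labels may be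 taken arbitrary.)
   Formalization: The formal theorem additionally assumes that, for a = 0,1, P(X ∈ I_a minus the interior of I_a) = 0; without it the claim fails, e.g. when η = 1/2 on a countable set dense in part of the classes, so that the sets A_a^δ miss positive mass as δ → 0. *)

theory Defs
  imports "HOL-Probability.Probability"
begin

definition msupport :: "'a::metric_space measure \<Rightarrow> 'a set" where
  "msupport \<mu> = {x. \<forall>r>0. emeasure \<mu> (ball x r) > 0}"

definition dilation :: "'a::metric_space set \<Rightarrow> real \<Rightarrow> 'a set" where
  "dilation A r = (\<Union>s\<in>A. ball s r)"

definition erosion :: "'a::metric_space set \<Rightarrow> real \<Rightarrow> 'a set" where
  "erosion A \<delta> = {x. ball x \<delta> \<subseteq> A}"

text \<open>
  The regression function E(Y | X = x): a Borel function that, composed with X, is the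
  conditional expectation of Y given the sigma-algebra generated by X, and that takes values in
  [0, 1] on the support of X. Its values off the support play no role below.
\<close>

definition regression_function ::
    "'w measure \<Rightarrow> ('w \<Rightarrow> 'a::euclidean_space) \<Rightarrow> ('w \<Rightarrow> real) \<Rightarrow> ('a \<Rightarrow> real) \<Rightarrow> bool" where
  "regression_function M X Y \<eta> \<longleftrightarrow>
     \<eta> \<in> borel_measurable borel \<and>
     (AE \<omega> in M. real_cond_exp M (vimage_algebra (space M) X borel) Y \<omega> = \<eta> (X \<omega>)) \<and>
     (\<forall>x\<in>msupport (distr M borel X). \<eta> x \<in> {0..1})"

definition bayes_rule :: "('a \<Rightarrow> real) \<Rightarrow> 'a \<Rightarrow> real" where
  "bayes_rule \<eta> x = of_bool (\<eta> x \<ge> 1 / 2)"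

text \<open>In the next two definitions the class index \<open>a\<close> is 0 or 1; \<open>1 - a\<close> is the other class.\<close>

definition class_region :: "'a set \<Rightarrow> ('a \<Rightarrow> real) \<Rightarrow> nat \<Rightarrow> 'a set" where
  "class_region S \<eta> a = {x \<in> S. \<eta> x \<in> (if a = 0 then {0..<1/2} else {1/2<..1})}"

definition border_region :: "'a::metric_space set \<Rightarrow> ('a \<Rightarrow> real) \<Rightarrow> nat \<Rightarrow> real \<Rightarrow> 'a set" where
  "border_region S \<eta> a h = class_region S \<eta> a \<inter> dilation (class_region S \<eta> (1 - a)) h"

text \<open>
  The classification algorithm. The training sample is \<open>(u r, v r)\<close> for \<open>r\<close> in \<open>{1..n}\<close>, the
  unlabelled points are \<open>x i\<close> for \<open>i\<close> in \<open>{1..l}\<close>, and \<open>h\<close> is the bandwidth. A state is the partial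
  map \<open>t\<close> that sends each index labelled so far to its assigned label. Points are tracked through
  their indices, so coinciding points are processed and averaged with multiplicity.
\<close>

definition labelled_locations ::
    "nat \<Rightarrow> (nat \<Rightarrow> 'a) \<Rightarrow> (nat \<Rightarrow> 'a) \<Rightarrow> (nat \<rightharpoonup> real) \<Rightarrow> 'a set" where
  "labelled_locations n u x t = u ` {1..n} \<union> x ` dom t"

text \<open>\<open>infdist\<close> to the empty set is 0, so the next definition is only meaningful for \<open>n > 0\<close>.\<close>

definition candidates ::
    "nat \<Rightarrow> (nat \<Rightarrow> 'a::metric_space) \<Rightarrow> nat \<Rightarrow> real \<Rightarrow> (nat \<Rightarrow> 'a) \<Rightarrow> (nat \<rightharpoonup> real) \<Rightarrow> nat set" where
  "candidates n u l h x t =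
     {i \<in> {1..l} - dom t. infdist (x i) (labelled_locations n u x t) < h}"

definition eta_hat ::
    "nat \<Rightarrow> (nat \<Rightarrow> 'a::metric_space) \<Rightarrow> (nat \<Rightarrow> real) \<Rightarrow> real \<Rightarrow> (nat \<Rightarrow> 'a) \<Rightarrow> (nat \<rightharpoonup> real)
      \<Rightarrow> nat \<Rightarrow> real" where
  "eta_hat n u v h x t i =
     (let R = {r \<in> {1..n}. u r \<in> ball (x i) h};
          Q = {r \<in> dom t. x r \<in> ball (x i) h}
      in ((\<Sum>r\<in>R. v r) + (\<Sum>r\<in>Q. the (t r))) / (real (card R) + real (card Q)))"

definition confidence ::
    "nat \<Rightarrow> (nat \<Rightarrow> 'a::metric_space) \<Rightarrow> (nat \<Rightarrow> real) \<Rightarrow> real \<Rightarrow> (nat \<Rightarrow> 'a) \<Rightarrow> (nat \<rightharpoonup> real)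
      \<Rightarrow> nat \<Rightarrow> real" where
  "confidence n u v h x t i = max (eta_hat n u v h x t i) (1 - eta_hat n u v h x t i)"

definition neighbour_count :: "nat \<Rightarrow> real \<Rightarrow> (nat \<Rightarrow> 'a::metric_space) \<Rightarrow> nat \<Rightarrow> nat" where
  "neighbour_count l h x i = card (x ` {1..l} \<inter> ball (x i) h)"

text \<open>Several indices may be selectable; the algorithm may pick any one of them.\<close>

definition selectable ::
    "nat \<Rightarrow> (nat \<Rightarrow> 'a::metric_space) \<Rightarrow> (nat \<Rightarrow> real) \<Rightarrow> nat \<Rightarrow> real \<Rightarrow> (nat \<Rightarrow> 'a) \<Rightarrow> (nat \<rightharpoonup> real)
      \<Rightarrow> nat \<Rightarrow> bool" where
  "selectable n u v l h x t i \<longleftrightarrow>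
     is_arg_max (confidence n u v h x t) (\<lambda>k. k \<in> candidates n u l h x t) i \<and>
     is_arg_max (neighbour_count l h x)
       (is_arg_max (confidence n u v h x t) (\<lambda>k. k \<in> candidates n u l h x t)) i"

definition step ::
    "nat \<Rightarrow> (nat \<Rightarrow> 'a::metric_space) \<Rightarrow> (nat \<Rightarrow> real) \<Rightarrow> nat \<Rightarrow> real \<Rightarrow> (nat \<Rightarrow> 'a)
      \<Rightarrow> (nat \<rightharpoonup> real) \<Rightarrow> (nat \<rightharpoonup> real) \<Rightarrow> bool" where
  "step n u v l h x t t' \<longleftrightarrow>
     (\<exists>i. selectable n u v l h x t i \<and> t' = t(i \<mapsto> of_bool (eta_hat n u v h x t i \<ge> 1 / 2)))"

text \<open>
  \<open>y\<close> is a possible family of final labels: it agrees with the state of some run that has stopped,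
  and is an arbitrary 0-1 label at indices that were never labelled. A run has at most \<open>l\<close> steps,
  because each step labels a new index of \<open>{1..l}\<close>.
\<close>

definition algorithm_labels ::
    "nat \<Rightarrow> (nat \<Rightarrow> 'a::metric_space) \<Rightarrow> (nat \<Rightarrow> real) \<Rightarrow> nat \<Rightarrow> real \<Rightarrow> (nat \<Rightarrow> 'a)
      \<Rightarrow> (nat \<Rightarrow> real) \<Rightarrow> bool" where
  "algorithm_labels n u v l h x y \<longleftrightarrow>
     (\<exists>t. (step n u v l h x)\<^sup>*\<^sup>* Map.empty t \<and> candidates n u l h x t = {} \<and>
          (\<forall>i\<in>{1..l}. if i \<in> dom t then y i = the (t i) else y i \<in> {0, 1}))"

definition error_rate :: "nat \<Rightarrow> (nat \<Rightarrow> real) \<Rightarrow> (nat \<Rightarrow> real) \<Rightarrow> real" where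
  "error_rate l y y' = (1 / real l) * (\<Sum>i=1..l. of_bool (y i \<noteq> y' i))"

definition density_estimate :: "nat \<Rightarrow> real \<Rightarrow> (nat \<Rightarrow> 'a::euclidean_space) \<Rightarrow> 'a \<Rightarrow> real" where
  "density_estimate l h x u =
     (\<Sum>i=1..l. indicator (ball u h) (x i)) /
     (measure lborel (ball (0::'a) 1) * real l * h ^ DIM('a))"

end

theory Submission
  imports Defs "HOL-Real_Asymp.Real_Asymp"
begin

text \<open>
  Fix a small \<open>\<delta>\<close> and call the points of \<open>A 0 \<delta> \<union> A 1 \<delta>\<close> core points. Suppose that all labels assigned
  so far are correct but a core point of class \<open>a\<close> is still unlabelled. As \<open>A a \<delta>\<close> is connected,
  contains a training point and is covered by the balls of radius \<open>h/2\<close> around the sample, some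
  unlabelled core point lies within \<open>h\<close> of a labelled point; all labels around it agree, so it is a
  candidate of maximal confidence 1. A point about to be mislabelled has a labelled point of the
  other class within \<open>h\<close>, so it lies in the border region, where the density is smaller by a margin
  \<open>\<gamma>\<close>; for large \<open>l\<close> it has fewer neighbours than the core candidate and loses the tie-break. Hence
  core points are labelled before the first mistake. The error rate therefore differs from that of
  the Bayes rule by at most the frequency of non-core points. The strong law of large numbers
  (Hoeffding's inequality and Borel-Cantelli) turns frequencies into probabilities, and the
  probability of the non-core points vanishes as \<open>\<delta> \<longlonglongrightarrow> 0\<close>, because each class is open up to a null
  set.
\<close>

section \<open>Runs of the algorithm\<close>

text \<open>A candidate has a labelled location within \<open>h\<close>, so the average runs over a
  nonempty set and a constant value survives. The hypothesis \<open>n > 0\<close> excludes an empty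
  set of locations, to which \<open>infdist\<close> would be 0.\<close>

lemma eta_hat_eq:
  assumes cand: "i \<in> candidates n u l h x t" and n: "n > 0"
    and fin: "finite (dom t)"
    and v: "\<And>r. r \<in> {1..n} \<Longrightarrow> dist (x i) (u r) < h \<Longrightarrow> v r = c"
    and t: "\<And>r. r \<in> dom t \<Longrightarrow> dist (x i) (x r) < h \<Longrightarrow> the (t r) = c"
  shows "eta_hat n u v h x t i = c"
proof -
  define R where "R = {r \<in> {1..n}. u r \<in> ball (x i) h}"
  define Q where "Q = {r \<in> dom t. x r \<in> ball (x i) h}"
  have finR: "finite R" and finQ: "finite Q"
    using fin by (auto simp: R_def Q_def)
  have "R \<union> Q \<noteq> {}"
  proof
    assume "R \<union> Q = {}"
    then have "\<And>p. p \<in> labelled_locations n u x t \<Longrightarrow> h \<le> dist (x i) p"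
      unfolding R_def Q_def labelled_locations_def by (fastforce simp: not_less)
    moreover have "labelled_locations n u x t \<noteq> {}"
      using n by (auto simp: labelled_locations_def)
    ultimately have "h \<le> infdist (x i) (labelled_locations n u x t)"
      by (simp add: infdist_notempty cINF_greatest)
    then show False
      using cand by (auto simp: candidates_def)
  qed
  then have "card R + card Q > 0"
    using finR finQ by (auto simp: card_gt_0_iff)
  moreover have "(\<Sum>r\<in>R. v r) = card R * c"
    using v by (simp add: R_def)
  moreover have "(\<Sum>r\<in>Q. the (t r)) = card Q * c"
    using t by (simp add: Q_def)
  ultimately show ?thesis
    unfolding eta_hat_def Let_def R_def[symmetric] Q_def[symmetric]
    by (simp flip: distrib_right of_nat_add)
qed

text \<open>This caps the confidence at 1. An empty window gives \<open>0 / 0 = 0\<close>, which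
  still lies in the interval.\<close>

lemma eta_hat_bounds:
  assumes v: "\<And>r. r \<in> {1..n} \<Longrightarrow> v r \<in> {0..1}"
    and t: "\<And>r. r \<in> dom t \<Longrightarrow> the (t r) \<in> {0..1}"
  shows "eta_hat n u v h x t i \<in> {0..1}"
proof -
  define R where "R = {r \<in> {1..n}. u r \<in> ball (x i) h}"
  define Q where "Q = {r \<in> dom t. x r \<in> ball (x i) h}"
  have "0 \<le> sum v R" "0 \<le> (\<Sum>r\<in>Q. the (t r))"
    using v t by (force intro!: sum_nonneg simp: R_def Q_def)+
  moreover have "sum v R \<le> card R * 1"
    using v sum_bounded_above[of R v 1] by (auto simp: R_def)
  moreover have "(\<Sum>r\<in>Q. the (t r)) \<le> card Q * 1"
    using t sum_bounded_above[of Q "\<lambda>r. the (t r)" 1] by (auto simp: Q_def)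
  ultimately show ?thesis
    unfolding eta_hat_def Let_def R_def[symmetric] Q_def[symmetric]
    by (auto simp: divide_le_eq_1)
qed

lemma run_dom_subset:
  assumes "(step n u v l h x)\<^sup>*\<^sup>* Map.empty t"
  shows "dom t \<subseteq> {1..l}"
  using assms
proof (induction rule: rtranclp_induct)
  case (step s t)
  then obtain i where "selectable n u v l h x s i" "dom t = insert i (dom s)"
    by (auto simp: step_def)
  then show ?case
    using step.IH by (auto simp: selectable_def is_arg_max_def candidates_def)
qed simp

text \<open>
  The correct label of a location \<open>z\<close> is \<open>c z\<close>. The last assumption makes the tie-breaking rule reject
  every point that has a differently labelled location within distance \<open>h\<close>, as long as it competes
  with a core point.
\<close>

locale core_cover =
  fixes n :: nat and u :: "nat \<Rightarrow> 'a::metric_space" and v :: "nat \<Rightarrow> real"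
    and l :: nat and h :: real and x :: "nat \<Rightarrow> 'a"
    and c :: "'a \<Rightarrow> real" and \<C> :: "'a set set"
  assumes c_binary: "c z \<in> {0, 1}"
    and training: "r \<in> {1..n} \<Longrightarrow> v r = c (u r)"
    and h_pos: "h > 0"
    and core_connected: "K \<in> \<C> \<Longrightarrow> connected K"
    and core_training: "K \<in> \<C> \<Longrightarrow> \<exists>r\<in>{1..n}. u r \<in> K"
    and core_covered: "K \<in> \<C> \<Longrightarrow> K \<subseteq> (\<Union>i\<in>{i \<in> {1..l}. x i \<in> K}. ball (x i) (h / 2))"
    and core_homogeneous: "q \<in> {1..l} \<Longrightarrow> x q \<in> \<Union>\<C> \<Longrightarrow> z \<in> u ` {1..n} \<union> x ` {1..l} \<Longrightarrow>
      dist (x q) z < h \<Longrightarrow> c z = c (x q)"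
    and core_denser: "q \<in> {1..l} \<Longrightarrow> x q \<in> \<Union>\<C> \<Longrightarrow> i \<in> {1..l} \<Longrightarrow>
      z \<in> u ` {1..n} \<union> x ` {1..l} \<Longrightarrow> dist (x i) z < h \<Longrightarrow> c z \<noteq> c (x i) \<Longrightarrow>
      neighbour_count l h x i < neighbour_count l h x q"
begin

text \<open>The balls of radius \<open>h / 2\<close> about labelled locations (\<open>U\<close>) and
  about unlabelled sample points of \<open>K\<close> (\<open>V\<close>) form two open sets that
  cover the connected set \<open>K\<close> and both meet it, so they overlap. Centres of overlapping
  balls are less than \<open>h\<close> apart.\<close>

lemma core_candidate:
  assumes dom: "dom t \<subseteq> {1..l}"
    and K: "K \<in> \<C>" and i: "i \<in> {1..l} - dom t" "x i \<in> K"
  shows "\<exists>q \<in> candidates n u l h x t. x q \<in> K"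
proof -
  define Q where "Q = {q \<in> {1..l} - dom t. x q \<in> K}"
  define U where "U = (\<Union>p\<in>labelled_locations n u x t. ball p (h / 2))"
  define V where "V = (\<Union>q\<in>Q. ball (x q) (h / 2))"
  have "K \<subseteq> U \<union> V"
  proof
    fix z assume "z \<in> K"
    then obtain k where "k \<in> {1..l}" "x k \<in> K" "z \<in> ball (x k) (h / 2)"
      using core_covered[OF K] by blast
    then show "z \<in> U \<union> V"
      by (cases "k \<in> dom t") (auto simp: U_def V_def Q_def labelled_locations_def)
  qed
  moreover have "open U" "open V"
    by (auto simp: U_def V_def)
  moreover have "U \<inter> K \<noteq> {}"
  proof -
    obtain r where "r \<in> {1..n}" "u r \<in> K"
      using core_training[OF K] by blast
    moreover from this have "u r \<in> U"
      unfolding U_def using h_pos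
      by (intro UN_I[of "u r"]) (auto simp: labelled_locations_def)
    ultimately show ?thesis by auto
  qed
  moreover have "V \<inter> K \<noteq> {}"
    using i h_pos by (force simp: V_def Q_def)
  ultimately obtain z where z: "z \<in> U" "z \<in> V"
    using core_connected[OF K] unfolding connected_def by blast
  from z obtain p q where p: "p \<in> labelled_locations n u x t" "dist p z < h / 2"
    and q: "q \<in> Q" "dist (x q) z < h / 2"
    by (auto simp: U_def V_def)
  have "dist (x q) p < h"
    using p(2) q(2) dist_triangle[of "x q" p z] by (simp add: dist_commute)
  with p(1) have "infdist (x q) (labelled_locations n u x t) < h"
    by (meson infdist_le le_less_trans)
  with q(1) show ?thesis
    by (auto simp: Q_def candidates_def)
qed

lemma n_pos: "K \<in> \<C> \<Longrightarrow> n > 0"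
  using core_training by force

text \<open>The core candidate \<open>q\<close> attains the maximal confidence 1, so the selected
  \<open>j\<close> must have at least as many neighbours as \<open>q\<close>. A wrong label for
  \<open>j\<close> would put a location of the other class near it, and \<open>core_denser\<close>
  then gives \<open>j\<close> strictly fewer.\<close>

lemma selected_label_correct:
  assumes K: "K \<in> \<C>" "i \<in> {1..l} - dom t" "x i \<in> K"
    and dom: "dom t \<subseteq> {1..l}"
    and correct: "\<And>r. r \<in> dom t \<Longrightarrow> the (t r) = c (x r)"
    and sel: "selectable n u v l h x t j"
  shows "of_bool (eta_hat n u v h x t j \<ge> 1 / 2) = c (x j)"
proof (rule ccontr)
  assume wrong: "of_bool (eta_hat n u v h x t j \<ge> 1 / 2) \<noteq> c (x j)"
  have n: "n > 0" and fin: "finite (dom t)"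
    using n_pos K(1) finite_subset[OF dom] by auto
  have j: "j \<in> candidates n u l h x t" "j \<in> {1..l}"
    using sel by (auto simp: selectable_def is_arg_max_def candidates_def)
  \<comment> \<open>If all locations within \<open>h\<close> had the correct label of
    \<open>x j\<close>, the average would equal that label, which is 0 or 1, and thresholding would
    return it.\<close>
  have "\<exists>z \<in> u ` {1..n} \<union> x ` {1..l}. dist (x j) z < h \<and> c z \<noteq> c (x j)"
  proof (rule ccontr)
    assume *: "\<not> ?thesis"
    have "eta_hat n u v h x t j = c (x j)"
      using * dom correct training by (intro eta_hat_eq[OF j(1) n fin]) auto
    with wrong c_binary[of "x j"] show False
      by auto
  qed
  then obtain z where z: "z \<in> u ` {1..n} \<union> x ` {1..l}" "dist (x j) z < h" "c z \<noteq> c (x j)"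
    by blast
  obtain q where q: "q \<in> candidates n u l h x t" "x q \<in> K"
    using core_candidate[OF dom K] by blast
  then have ql: "q \<in> {1..l}" "x q \<in> \<Union>\<C>"
    using K by (auto simp: candidates_def)
  have "eta_hat n u v h x t q = c (x q)"
  proof (rule eta_hat_eq[OF q(1) n fin])
    show "v r = c (x q)" if "r \<in> {1..n}" "dist (x q) (u r) < h" for r
      using core_homogeneous[OF ql, of "u r"] that training by auto
    show "the (t r) = c (x q)" if "r \<in> dom t" "dist (x q) (x r) < h" for r
      using core_homogeneous[OF ql, of "x r"] that correct dom by auto
  qed
  then have conf_q: "confidence n u v h x t q = 1"
    using c_binary[of "x q"] by (auto simp: confidence_def)
  have conf_le: "confidence n u v h x t k \<le> 1" for k
  proof -
    have "c z \<in> {0..1}" for z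
      using c_binary[of z] by auto
    then have "eta_hat n u v h x t k \<in> {0..1}"
      using training correct by (intro eta_hat_bounds) auto
    then show ?thesis
      by (auto simp: confidence_def)
  qed
  \<comment> \<open>No confidence exceeds 1, so \<open>q\<close> is one of the maximizers among
    which the neighbour count decides.\<close>
  have "is_arg_max (confidence n u v h x t) (\<lambda>k. k \<in> candidates n u l h x t) q"
    using q(1) conf_q conf_le by (auto simp: is_arg_max_def not_less)
  then have "neighbour_count l h x q \<le> neighbour_count l h x j"
    using sel by (auto simp: selectable_def is_arg_max_def not_less)
  with core_denser[OF ql j(2) z] show False
    by simp
qed

text \<open>Correctness of all labels, \<open>C\<close>, may break once the core is exhausted, hence
  the disjunction with \<open>G\<close> as invariant. \<open>G\<close> persists because each step
  labels a new index and overwrites nothing.\<close>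

theorem core_labelled_correctly:
  assumes "algorithm_labels n u v l h x y" and "i \<in> {1..l}" and "x i \<in> \<Union>\<C>"
  shows "y i = c (x i)"
proof -
  define G where "G t \<longleftrightarrow> (\<forall>k\<in>{1..l}. x k \<in> \<Union>\<C> \<longrightarrow> t k = Some (c (x k)))" for t
  define C where "C t \<longleftrightarrow> (\<forall>k\<in>dom t. t k = Some (c (x k)))" for t
  from assms(1) obtain t where run: "(step n u v l h x)\<^sup>*\<^sup>* Map.empty t"
    and final: "candidates n u l h x t = {}"
    and y: "\<And>i. i \<in> {1..l} \<Longrightarrow> i \<in> dom t \<Longrightarrow> y i = the (t i)"
    by (auto simp: algorithm_labels_def)
  from assms obtain K where K: "K \<in> \<C>" "x i \<in> K"
    by blast
  \<comment> \<open>a run makes no mistake before all core points have been labelled, and labelled correctly\<close>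
  have "C t \<or> G t"
    using run
  proof (induction rule: rtranclp_induct)
    case base
    then show ?case by (simp add: C_def)
  next
    case (step s t)
    from step.hyps(2) obtain j where sel: "selectable n u v l h x s j"
      and t: "t = s(j \<mapsto> of_bool (eta_hat n u v h x s j \<ge> 1 / 2))"
      by (auto simp: step_def)
    have j: "j \<in> {1..l}" "j \<notin> dom s"
      using sel by (auto simp: selectable_def is_arg_max_def candidates_def)
    note dom = run_dom_subset[OF step.hyps(1)]
    show ?case
    proof (cases "G s")
      case True
      then have "x j \<notin> \<Union>\<C>"
        using j unfolding G_def by blast
      with True have "G t"
        unfolding G_def t by auto
      then show ?thesis ..
    next
      case False
      with step.IH have C: "C s" by simp
      \<comment> \<open>By \<open>C s\<close> every labelled core index is correct, so
        \<open>G s\<close> can only fail at an unlabelled one.\<close>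
      with False obtain k where "k \<in> {1..l} - dom s" "x k \<in> \<Union>\<C>"
        unfolding G_def C_def by blast
      then obtain K where "K \<in> \<C>" "k \<in> {1..l} - dom s" "x k \<in> K"
        by blast
      from selected_label_correct[OF this dom _ sel] C
      have "of_bool (eta_hat n u v h x s j \<ge> 1 / 2) = c (x j)"
        by (force simp: C_def)
      with C have "C t"
        unfolding C_def t by auto
      then show ?thesis ..
    qed
  qed
  \<comment> \<open>An unlabelled core index would produce a candidate, but a stopped run has
    none.\<close>
  moreover have "i \<in> dom t"
    using core_candidate[OF run_dom_subset[OF run] K(1)] K(2) assms(2) final by blast
  ultimately have "t i = Some (c (x i))"
    using assms by (auto simp: C_def G_def)
  then show ?thesis
    using y[of i] assms(2) \<open>i \<in> dom t\<close> by simp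
qed

end

section \<open>Independent samples\<close>

text \<open>For fixed \<open>\<epsilon>\<close> the Hoeffding bound is geometric in
  \<open>l\<close>, hence summable, and Borel-Cantelli applies. The bound is used for
  \<open>l \<ge> 1\<close> only, which does not affect summability.\<close>

lemma (in prob_space) iid_frequency_tendsto:
  fixes Z :: "nat \<Rightarrow> 'a \<Rightarrow> 'b"
  assumes indep: "indep_vars (\<lambda>_. S) Z {1..}"
    and distr: "\<And>i. i \<ge> 1 \<Longrightarrow> distr M S (Z i) = distr M S W"
    and [measurable]: "W \<in> measurable M S" "C \<in> sets S"
  shows "AE \<omega> in M. (\<lambda>l. (1 / real l) * (\<Sum>i=1..l. of_bool (Z i \<omega> \<in> C)))
           \<longlonglongrightarrow> prob {\<omega> \<in> space M. W \<omega> \<in> C}"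
proof -
  define \<mu> where "\<mu> = prob {\<omega> \<in> space M. W \<omega> \<in> C}"
  define m where "m l \<omega> = (\<Sum>i=1..l. of_bool (Z i \<omega> \<in> C) :: real) / real l" for l \<omega>
  have [measurable]: "Z i \<in> measurable M S" if "i \<ge> 1" for i
    using indep that unfolding indep_vars_def by auto
  have [measurable]: "m l \<in> borel_measurable M" for l
    unfolding m_def by measurable
  have bound: "prob {\<omega> \<in> space M. \<bar>m l \<omega> - \<mu>\<bar> \<ge> \<epsilon>} \<le> 2 * exp (-2 * \<epsilon>\<^sup>2) ^ l"
    if "l \<ge> 1" "\<epsilon> > 0" for l \<epsilon>
  proof -
    have exp_W: "expectation (\<lambda>\<omega>. of_bool (W \<omega> \<in> C) :: real) = \<mu>"
    proof -
      have "expectation (\<lambda>\<omega>. of_bool (W \<omega> \<in> C) :: real)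
        = expectation (indicator {\<omega> \<in> space M. W \<omega> \<in> C})"
        by (intro Bochner_Integration.integral_cong) auto
      then show ?thesis
        by (simp add: \<mu>_def)
    qed
    interpret H: Hoeffding_ineq_iid M "{1..l}" "\<lambda>i \<omega>. of_bool (Z i \<omega> \<in> C)"
      "\<lambda>\<omega>. of_bool (W \<omega> \<in> C)" 0 1 \<mu>
    proof unfold_locales
      have "indep_vars (\<lambda>_. S) Z {1..l}"
        using indep by (rule indep_vars_subset) auto
      then show "indep_vars (\<lambda>_. borel) (\<lambda>i \<omega>. of_bool (Z i \<omega> \<in> C) :: real) {1..l}"
        by (rule indep_vars_compose2) measurable
      show "distr M borel (\<lambda>\<omega>. of_bool (Z i \<omega> \<in> C) :: real)
          = distr M borel (\<lambda>\<omega>. of_bool (W \<omega> \<in> C))" if "i \<in> {1..l}" for i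
      proof -
        have "distr M borel (\<lambda>\<omega>. of_bool (Z i \<omega> \<in> C) :: real)
            = distr (distr M S (Z i)) borel (\<lambda>z. of_bool (z \<in> C))"
          using that by (subst distr_distr) (auto simp: comp_def)
        also have "distr M S (Z i) = distr M S W"
          using that by (intro distr) auto
        also have "distr \<dots> borel (\<lambda>z. of_bool (z \<in> C) :: real)
            = distr M borel (\<lambda>\<omega>. of_bool (W \<omega> \<in> C))"
          by (subst distr_distr) (auto simp: comp_def)
        finally show ?thesis .
      qed
    qed (auto simp: exp_W)
    have "prob {\<omega> \<in> space M. \<bar>m l \<omega> - \<mu>\<bar> \<ge> \<epsilon>} \<le> 2 * exp (-2 * real l * \<epsilon>\<^sup>2)"
      using H.Hoeffding_ineq_abs_ge'[of \<epsilon>] that by (simp add: m_def)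
    also have "exp (-2 * real l * \<epsilon>\<^sup>2) = exp (-2 * \<epsilon>\<^sup>2) ^ l"
      by (simp add: mult_ac flip: exp_of_nat_mult)
    finally show ?thesis .
  qed
  have "AE \<omega> in M. \<forall>\<^sub>F l in sequentially. \<bar>m l \<omega> - \<mu>\<bar> < \<epsilon>" if "\<epsilon> > 0" for \<epsilon>
  proof -
    define E where "E l = {\<omega> \<in> space M. \<bar>m l \<omega> - \<mu>\<bar> \<ge> \<epsilon>}" for l
    have "AE \<omega> in M. \<forall>\<^sub>F l in sequentially. \<omega> \<in> space M - E l"
    proof (rule borel_cantelli_AE1)
      show "E l \<in> events" for l
        unfolding E_def by measurable
      have "summable (\<lambda>l. 2 * exp (-2 * \<epsilon>\<^sup>2) ^ l)"
        using that by (intro summable_mult summable_geometric) auto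
      then show "summable (\<lambda>l. prob (E l))"
        by (rule summable_comparison_test_ev[rotated])
           (use bound that in \<open>auto simp: E_def eventually_sequentially intro!: exI[of _ 1]\<close>)
    qed (simp add: less_top[symmetric])
    then show ?thesis
      by eventually_elim (auto simp: E_def not_le elim: eventually_mono)
  qed
  \<comment> \<open>Countably many tolerances suffice, so a single null set serves all of
    them.\<close>
  then have "AE \<omega> in M. \<forall>k. \<forall>\<^sub>F l in sequentially. \<bar>m l \<omega> - \<mu>\<bar> < inverse (real (Suc k))"
    by (intro AE_all_countable[THEN iffD2]) auto
  then show ?thesis
  proof eventually_elim
    case (elim \<omega>)
    have "(\<lambda>l. m l \<omega>) \<longlonglongrightarrow> \<mu>"
    proof (rule tendstoI)
      fix e :: real assume "e > 0"
      then obtain k where "inverse (real (Suc k)) < e"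
        using reals_Archimedean by blast
      with elim show "\<forall>\<^sub>F l in sequentially. dist (m l \<omega>) \<mu> < e"
        by (auto simp: dist_real_def elim!: eventually_mono dest!: spec[of _ k])
    qed
    then show ?case
      by (simp add: m_def[abs_def] \<mu>_def)
  qed
qed

text \<open>By Fubini the product law of two sample points gives the diagonal mass 0, since its
  sections are single points. Distinctness reconciles \<open>neighbour_count\<close>, which counts
  points, with \<open>density_estimate\<close>, which counts indices.\<close>

lemma (in prob_space) iid_distinct:
  fixes Z :: "nat \<Rightarrow> 'a \<Rightarrow> 'b::euclidean_space \<times> 'c::second_countable_topology"
  assumes indep: "indep_vars (\<lambda>_. borel \<Otimes>\<^sub>M borel) Z {1..}"
    and diffuse: "\<And>i z. i \<ge> 1 \<Longrightarrow> AE w in distr M borel (\<lambda>\<omega>. fst (Z i \<omega>)). w \<noteq> z"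
  shows "AE \<omega> in M. inj_on (\<lambda>i. fst (Z i \<omega>)) {1..}"
proof -
  define X where "X i \<omega> = fst (Z i \<omega>)" for i \<omega>
  have [measurable]: "Z i \<in> measurable M (borel \<Otimes>\<^sub>M borel)" if "i \<ge> 1" for i
    using indep that unfolding indep_vars_def by auto
  have [measurable]: "X i \<in> borel_measurable M" if "i \<ge> 1" for i
    using that unfolding X_def by measurable
  have "AE \<omega> in M. X i \<omega> \<noteq> X j \<omega>" if ij: "i \<ge> 1" "j \<ge> 1" "i \<noteq> j" for i j
  proof -
    have "indep_vars (\<lambda>_. borel) X {1..}"
      unfolding X_def using indep by (rule indep_vars_compose2) measurable
    \<comment> \<open>Disjoint index sets give independent tuples; for singletons, projecting to the
      only coordinate yields \<open>X i\<close> and \<open>X j\<close>.\<close>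
    then have "indep_var (PiM {i} (\<lambda>_. borel)) (\<lambda>\<omega>. \<lambda>k\<in>{i}. X k \<omega>)
        (PiM {j} (\<lambda>_. borel)) (\<lambda>\<omega>. \<lambda>k\<in>{j}. X k \<omega>)"
      by (rule indep_var_restrict) (use ij in auto)
    from indep_var_compose[OF this, of "\<lambda>f. f i" borel "\<lambda>f. f j" borel]
    have "indep_var borel (X i) borel (X j)"
      by (simp add: comp_def)
    then have eq: "distr M borel (X i) \<Otimes>\<^sub>M distr M borel (X j)
        = distr M (borel \<Otimes>\<^sub>M borel) (\<lambda>\<omega>. (X i \<omega>, X j \<omega>))"
      by (simp add: indep_var_distribution_eq)
    interpret D1: prob_space "distr M borel (X i)"
      using ij by (intro prob_space_distr) auto
    interpret D2: prob_space "distr M borel (X j)"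
      using ij by (intro prob_space_distr) auto
    interpret P: pair_sigma_finite "distr M borel (X i)" "distr M borel (X j)" ..
    have "AE p in distr M borel (X i) \<Otimes>\<^sub>M distr M borel (X j). fst p \<noteq> snd p"
    proof (rule P.AE_pair_measure)
      show "{p \<in> space (distr M borel (X i) \<Otimes>\<^sub>M distr M borel (X j)). fst p \<noteq> snd p}
          \<in> sets (distr M borel (X i) \<Otimes>\<^sub>M distr M borel (X j))"
        by measurable
      show "AE w in distr M borel (X i). AE w' in distr M borel (X j). fst (w, w') \<noteq> snd (w, w')"
        using diffuse[OF ij(2)] unfolding X_def by (auto simp: eq_commute[of _ "_::'b"] intro!: AE_I2 elim: eventually_mono)
    qed
    then have "AE p in distr M (borel \<Otimes>\<^sub>M borel) (\<lambda>\<omega>. (X i \<omega>, X j \<omega>)). fst p \<noteq> snd p"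
      unfolding eq .
    from AE_distrD[OF _ this] ij show ?thesis
      by simp
  qed
  then have "AE \<omega> in M. \<forall>i j. i \<ge> 1 \<longrightarrow> j \<ge> 1 \<longrightarrow> i \<noteq> j \<longrightarrow> X i \<omega> \<noteq> X j \<omega>"
    by (simp add: AE_all_countable)
  then show ?thesis
    by eventually_elim (auto simp: inj_on_def X_def)
qed

text \<open>Singletons are Lebesgue null; this supplies the diffuseness hypothesis of
  \<open>iid_distinct\<close>.\<close>

lemma distributed_lborel_diffuse:
  fixes X :: "'w \<Rightarrow> 'a::euclidean_space"
  assumes "distributed M lborel X f"
  shows "AE w in distr M borel X. w \<noteq> z"
proof -
  have "distr M borel X = distr M lborel X"
    by (rule distr_cong) auto
  then have "distr M borel X = density lborel f" "f \<in> borel_measurable lborel"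
    using assms by (simp_all add: distributed_def)
  then show ?thesis
    using AE_lborel_singleton[of z] by (simp only: AE_density) auto
qed

section \<open>Correct labels on the cores of the classes\<close>

text \<open>Every point of a null ball has a smaller ball inside it, null by monotonicity.
  Closedness makes the support Borel.\<close>

lemma closed_msupport:
  assumes "sets \<mu> = sets borel"
  shows "closed (msupport \<mu>)"
proof -
  have "\<exists>r>0. ball x r \<subseteq> - msupport \<mu>" if x: "x \<notin> msupport \<mu>" for x
  proof -
    from x obtain r where r: "r > 0" "emeasure \<mu> (ball x r) = 0"
      by (auto simp: msupport_def)
    have "y \<notin> msupport \<mu>" if y: "y \<in> ball x r" for y
    proof -
      obtain e where e: "e > 0" "ball y e \<subseteq> ball x r"
        using y open_ball openE by blast
      then have "emeasure \<mu> (ball y e) \<le> emeasure \<mu> (ball x r)"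
        using assms by (intro emeasure_mono) auto
      with e r show ?thesis
        by (force simp: msupport_def)
    qed
    with r show ?thesis by blast
  qed
  then show ?thesis
    unfolding closed_def by (auto simp: open_contains_ball)
qed

text \<open>A point fails to be in the erosion exactly when it is within \<open>\<delta>\<close> of
  the complement of \<open>A\<close>. This makes the cores Borel.\<close>

lemma closed_erosion: "closed (erosion A \<delta>)"
proof -
  have "- erosion A \<delta> = (\<Union>y\<in>-A. ball y \<delta>)"
    by (auto simp: erosion_def dist_commute)
  then show ?thesis
    by (metis closed_open open_UN open_ball)
qed

lemma erosion_antimono: "\<delta> \<le> \<delta>' \<Longrightarrow> erosion A \<delta>' \<subseteq> erosion A \<delta>"
  by (auto simp: erosion_def)

lemma bayes_rule_class_region:
  assumes "a \<in> {0, 1}" and "z \<in> class_region S \<eta> a"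
  shows "bayes_rule \<eta> z = real a"
  using assms by (auto simp: bayes_rule_def class_region_def)

text \<open>This deterministic statement instantiates \<open>core_cover\<close> with the Bayes rule
  and the two cores. Homogeneity comes from \<open>h \<le> \<delta>\<close>, which keeps the
  \<open>h\<close>-ball of a core point inside its class; the tie-break condition comes from the
  density gap.\<close>

lemma core_labels_correct:
  fixes u x :: "nat \<Rightarrow> 'a::euclidean_space"
  assumes u: "\<And>i. i \<in> {1..n} \<Longrightarrow> u i \<in> class_region S \<eta> 0 \<union> class_region S \<eta> 1"
    and v: "\<And>i. i \<in> {1..n} \<Longrightarrow> v i = bayes_rule \<eta> (u i)"
    and training: "\<And>a. a \<in> {0, 1} \<Longrightarrow> \<exists>i\<in>{1..n}. u i \<in> erosion (class_region S \<eta> a) \<delta>"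
    and x: "\<And>i. i \<in> {1..l} \<Longrightarrow> x i \<in> class_region S \<eta> 0 \<union> class_region S \<eta> 1"
    and inj: "inj_on x {1..l}"
    and h: "0 < h" "h \<le> \<delta>"
    and conn: "\<And>a. a \<in> {0, 1} \<Longrightarrow> connected (erosion (class_region S \<eta> a) \<delta>)"
    and cover: "\<And>a. a \<in> {0, 1} \<Longrightarrow> erosion (class_region S \<eta> a) \<delta>
        \<subseteq> (\<Union>z \<in> x ` {1..l} \<inter> erosion (class_region S \<eta> a) \<delta>. ball z (h / 2))"
    and density: "\<And>z. z \<in> S \<Longrightarrow> \<bar>density_estimate l h x z - f z\<bar> < \<gamma> / 2"
    and gap: "\<And>a b. a \<in> erosion (class_region S \<eta> 0) \<delta> \<union> erosion (class_region S \<eta> 1) \<delta> \<Longrightarrow>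
        b \<in> border_region S \<eta> 0 h \<union> border_region S \<eta> 1 h \<Longrightarrow> f a - f b > \<gamma>"
    and alg: "algorithm_labels n u v l h x y"
    and i: "i \<in> {1..l}" "x i \<in> erosion (class_region S \<eta> 0) \<delta> \<union> erosion (class_region S \<eta> 1) \<delta>"
  shows "y i = bayes_rule \<eta> (x i)"
proof -
  define I where "I = class_region S \<eta>"
  have locs: "z \<in> I 0 \<union> I 1" if "z \<in> u ` {1..n} \<union> x ` {1..l}" for z
    using that u x unfolding I_def by blast
  have bayes: "bayes_rule \<eta> z = real a" if "a \<in> {0, 1}" "z \<in> I a" for a z
    using that unfolding I_def by (rule bayes_rule_class_region)
  have in_S: "z \<in> S" if "z \<in> I a" for a z
    using that by (auto simp: I_def class_region_def)
  \<comment> \<open>Since \<open>x\<close> is injective, counting indices is counting points, so the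
    estimate is \<open>neighbour_count\<close> over a common normalizing factor.\<close>
  have count: "density_estimate l h x z
      = card (x ` {1..l} \<inter> ball z h) / (measure lborel (ball (0::'a) 1) * real l * h ^ DIM('a))" for z
  proof -
    have "(\<Sum>i=1..l. indicator (ball z h) (x i)) = (\<Sum>w\<in>x ` {1..l}. indicator (ball z h) w :: real)"
      using inj by (simp add: sum.reindex)
    also have "\<dots> = (\<Sum>w\<in>x ` {1..l} \<inter> ball z h. 1)"
      by (intro sum.mono_neutral_cong_right) auto
    finally show ?thesis
      by (simp add: density_estimate_def)
  qed
  have l: "l > 0"
    using i by auto
  interpret core_cover n u v l h x "bayes_rule \<eta>" "{erosion (I 0) \<delta>, erosion (I 1) \<delta>}"
  proof
    show "bayes_rule \<eta> z \<in> {0, 1}" for z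
      by (auto simp: bayes_rule_def)
    show "v r = bayes_rule \<eta> (u r)" if "r \<in> {1..n}" for r
      using v that by blast
    show "0 < h" by fact
    fix K assume "K \<in> {erosion (I 0) \<delta>, erosion (I 1) \<delta>}"
    then obtain a where a: "a \<in> {0, 1}" "K = erosion (I a) \<delta>"
      by blast
    show "connected K" "\<exists>r\<in>{1..n}. u r \<in> K"
      using conn[OF a(1)] training[OF a(1)] a(2) by (simp_all add: I_def)
    have "x ` {1..l} \<inter> K = x ` {i \<in> {1..l}. x i \<in> K}"
      by auto
    then show "K \<subseteq> (\<Union>i\<in>{i \<in> {1..l}. x i \<in> K}. ball (x i) (h / 2))"
      using cover[OF a(1)] unfolding a(2) I_def by simp
  next
    fix q z
    assume q: "q \<in> {1..l}" "x q \<in> \<Union> {erosion (I 0) \<delta>, erosion (I 1) \<delta>}" "dist (x q) z < h"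
    then obtain a where a: "a \<in> {0, 1}" "ball (x q) \<delta> \<subseteq> I a"
      by (auto simp: erosion_def)
    then have "z \<in> I a" "x q \<in> I a"
      using q h by (auto simp: subset_iff)
    then show "bayes_rule \<eta> z = bayes_rule \<eta> (x q)"
      using bayes a(1) by metis
  next
    fix q i z
    assume q: "q \<in> {1..l}" "x q \<in> \<Union> {erosion (I 0) \<delta>, erosion (I 1) \<delta>}" and i: "i \<in> {1..l}"
      and z: "z \<in> u ` {1..n} \<union> x ` {1..l}" "dist (x i) z < h" "bayes_rule \<eta> z \<noteq> bayes_rule \<eta> (x i)"
    obtain a where a: "a \<in> {0, 1}" "x i \<in> I a"
      using locs[of "x i"] i by blast
    obtain b where b: "b \<in> {0, 1}" "z \<in> I b"
      using locs[OF z(1)] by blast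
    \<comment> \<open>Different labels mean opposite classes, so \<open>x i\<close> is within
      \<open>h\<close> of the other class.\<close>
    have "b = 1 - a"
      using bayes[OF a] bayes[OF b] z(3) a(1) b(1) by auto
    with a b z(2) have "x i \<in> border_region S \<eta> a h"
      unfolding border_region_def dilation_def I_def by (auto simp: dist_commute)
    then have "x i \<in> border_region S \<eta> 0 h \<union> border_region S \<eta> 1 h"
      using a(1) by auto
    moreover have "x q \<in> S" "x i \<in> S"
      using locs[of "x q"] locs[of "x i"] in_S q(1) i by blast+
    ultimately have "f (x q) - f (x i) > \<gamma>"
        "\<bar>density_estimate l h x (x q) - f (x q)\<bar> < \<gamma> / 2"
        "\<bar>density_estimate l h x (x i) - f (x i)\<bar> < \<gamma> / 2"
      using gap[of "x q" "x i"] density[of "x q"] density[of "x i"] q(2) by (simp_all add: I_def)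
    \<comment> \<open>Two errors below \<open>\<gamma> / 2\<close> cannot close a gap above
      \<open>\<gamma>\<close>.\<close>
    then have "density_estimate l h x (x i) < density_estimate l h x (x q)"
      by linarith
    moreover have "measure lborel (ball (0::'a) 1) * real l * h ^ DIM('a) > 0"
      using content_ball_pos[of 1 "0::'a"] l h by (simp add: measure_completion)
    ultimately show "neighbour_count l h x i < neighbour_count l h x q"
      unfolding count neighbour_count_def by (simp add: divide_less_cancel)
  qed
  show ?thesis
    using core_labelled_correctly[OF alg i(1)] i(2) by (simp add: I_def)
qed

section \<open>Convergence of the error rate\<close>

text \<open>Summands agree outside the exceptional set \<open>D\<close> and differ by at most 1 on
  it.\<close>

lemma error_rate_diff_le:
  assumes "\<And>i. i \<in> {1..l} \<Longrightarrow> i \<notin> D \<Longrightarrow> y i = z i"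
  shows "\<bar>error_rate l y y' - error_rate l z y'\<bar> \<le> (1 / real l) * (\<Sum>i=1..l. of_bool (i \<in> D))"
proof -
  have "\<bar>error_rate l y y' - error_rate l z y'\<bar>
      = (1 / real l) * \<bar>\<Sum>i=1..l. of_bool (y i \<noteq> y' i) - of_bool (z i \<noteq> y' i)\<bar>"
    unfolding error_rate_def sum_subtractf right_diff_distrib[symmetric] abs_mult by simp
  also have "\<dots> \<le> (1 / real l) * (\<Sum>i=1..l. \<bar>of_bool (y i \<noteq> y' i) - of_bool (z i \<noteq> y' i)\<bar>)"
    by (intro mult_left_mono sum_abs) auto
  also have "\<dots> \<le> (1 / real l) * (\<Sum>i=1..l. of_bool (i \<in> D))"
    using assms by (intro mult_left_mono sum_mono) (auto simp: of_bool_def)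
  finally show ?thesis .
qed

lemma error_rate_bounds: "error_rate l y y' \<in> {0..1}"
proof -
  have "(\<Sum>i=1..l. of_bool (y i \<noteq> y' i)) \<le> (\<Sum>i=1..l. 1 :: real)"
    by (intro sum_mono) auto
  then show ?thesis
    by (auto simp: error_rate_def divide_le_eq_1 sum_nonneg)
qed

text \<open>The limit superior of the distance between \<open>a\<close> and \<open>b\<close> is at
  most \<open>p m\<close> for every \<open>m\<close>, hence 0. Here \<open>m\<close> will index
  shrinking core margins.\<close>

lemma tendsto_via_approximations:
  fixes p :: "nat \<Rightarrow> real"
  assumes close: "\<And>m. \<forall>\<^sub>F l in F. \<bar>a l - b l\<bar> \<le> c m l"
    and c: "\<And>m. (c m \<longlongrightarrow> p m) F" and p: "p \<longlonglongrightarrow> 0" and b: "(b \<longlongrightarrow> L) F"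
  shows "(a \<longlongrightarrow> L) F"
proof -
  have "((\<lambda>l. a l - b l) \<longlongrightarrow> 0) F"
  proof (rule tendstoI)
    fix e :: real assume "e > 0"
    then obtain m where "p m < e"
      using order_tendstoD(2)[OF p, of e] by (auto simp: eventually_sequentially)
    from close[of m] order_tendstoD(2)[OF c this]
    show "\<forall>\<^sub>F l in F. dist (a l - b l) 0 < e"
      by eventually_elim simp
  qed
  from tendsto_add[OF this b] show ?thesis
    by simp
qed

theorem theorem1:
  fixes M :: "'w measure" and N :: "'v measure"
    and X :: "'w \<Rightarrow> 'a::euclidean_space" and Y :: "'w \<Rightarrow> real"
    and Xs :: "nat \<Rightarrow> 'w \<Rightarrow> 'a" and Ys :: "nat \<Rightarrow> 'w \<Rightarrow> real"
    and n :: nat and XT :: "nat \<Rightarrow> 'v \<Rightarrow> 'a" and YT :: "nat \<Rightarrow> 'v \<Rightarrow> real" and \<omega>0 :: 'v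
    and \<eta> f :: "'a \<Rightarrow> real" and h :: "nat \<Rightarrow> real"
    and g :: "nat \<Rightarrow> (nat \<Rightarrow> 'a) \<Rightarrow> nat \<Rightarrow> real"
    and S :: "'a set" and I :: "nat \<Rightarrow> 'a set" and A B :: "nat \<Rightarrow> real \<Rightarrow> 'a set"
  defines "S \<equiv> msupport (distr M borel X)"
    and "I \<equiv> class_region S \<eta>"
    and "A \<equiv> (\<lambda>a \<delta>. erosion (I a) \<delta>)"
    and "B \<equiv> border_region S \<eta>"
  assumes "prob_space M"
    \<comment> \<open>the generic pair and its regression function\<close>
    and "X \<in> borel_measurable M" and "Y \<in> borel_measurable M"
    and "\<forall>\<omega>\<in>space M. X \<omega> \<in> S \<and> Y \<omega> \<in> {0, 1}"
    and "regression_function M X Y \<eta>"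
    \<comment> \<open>regularity convention for the version of \<open>\<eta>\<close> (an extra assumption): up to null sets each
       class is open. The version is otherwise arbitrary on null sets, and the conclusion can fail
       if, say, \<open>\<eta> = 1/2\<close> on a countable set that is dense in part of a class.\<close>
    and eta_version: "\<forall>a\<in>{0, 1}. measure M {\<omega> \<in> space M. X \<omega> \<in> I a - interior (I a)} = 0"
    \<comment> \<open>iid copies\<close>
    and "prob_space.indep_vars M (\<lambda>_. borel \<Otimes>\<^sub>M borel) (\<lambda>i \<omega>. (Xs i \<omega>, Ys i \<omega>)) {1..}"
    and "\<forall>i\<ge>1. distr M (borel \<Otimes>\<^sub>M borel) (\<lambda>\<omega>. (Xs i \<omega>, Ys i \<omega>))
                = distr M (borel \<Otimes>\<^sub>M borel) (\<lambda>\<omega>. (X \<omega>, Y \<omega>))"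
    \<comment> \<open>training sample and its fixed realization\<close>
    and "prob_space N"
    and "\<forall>i\<in>{1..n}. XT i \<in> borel_measurable N \<and> YT i \<in> borel_measurable N \<and>
           (\<forall>\<omega>\<in>space N. XT i \<omega> \<in> S \<and> YT i \<omega> \<in> {0, 1}) \<and>
           distr N (borel \<Otimes>\<^sub>M borel) (\<lambda>\<omega>. (XT i \<omega>, YT i \<omega>))
             = distr M (borel \<Otimes>\<^sub>M borel) (\<lambda>\<omega>. (X \<omega>, Y \<omega>))"
    and "\<omega>0 \<in> space N"
    and "\<forall>i\<in>{1..n}. \<eta> (XT i \<omega>0) \<noteq> 1 / 2"
    and "\<forall>l. h l > 0" and "h \<longlonglongrightarrow> 0"
    and H1: "measure M {\<omega> \<in> space M. X \<omega> \<in> S \<and> \<eta> (X \<omega>) = 1 / 2} = 0"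
    and H2: "\<forall>a\<in>{0, 1}. connected (I a) \<and> measure M {\<omega> \<in> space M. X \<omega> \<in> I a} > 0"
    and H3: "\<forall>a\<in>{0, 1}. AE \<omega> in M. \<exists>l0. \<forall>l\<ge>l0.
               I a \<subseteq> (\<Union>x \<in> (\<lambda>i. Xs i \<omega>) ` {1..l} \<inter> I a. ball x (h l / 2))"
    and H5: "\<exists>\<delta>0>0. \<forall>a\<in>{0, 1}. \<forall>\<delta>. 0 < \<delta> \<and> \<delta> < \<delta>0 \<longrightarrow> connected (A a \<delta>) \<and>
               (AE \<omega> in M. \<exists>l0. \<forall>l\<ge>l0.
                  A a \<delta> \<subseteq> (\<Union>x \<in> (\<lambda>i. Xs i \<omega>) ` {1..l} \<inter> A a \<delta>. ball x (h l / 2)))"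
    and H6: "(\<forall>x. f x \<ge> 0) \<and> distributed M lborel X (\<lambda>x. ennreal (f x))"
            "\<exists>\<delta>1>0. \<forall>\<delta>. 0 < \<delta> \<and> \<delta> < \<delta>1 \<longrightarrow> (\<exists>\<gamma>>0. \<forall>h'. 0 < h' \<and> h' < \<delta> \<longrightarrow>
               (\<forall>a \<in> A 0 \<delta> \<union> A 1 \<delta>. \<forall>b \<in> B 0 h' \<union> B 1 h'. f a - f b > \<gamma>))"
    and H7: "\<forall>\<epsilon>>0. AE \<omega> in M. \<exists>l0. \<forall>l\<ge>l0.
               (SUP u\<in>S. ereal \<bar>density_estimate l (h l) (\<lambda>i. Xs i \<omega>) u - f u\<bar>) < ereal \<epsilon>"
    and H8: "\<forall>i\<in>{1..n}. YT i \<omega>0 = bayes_rule \<eta> (XT i \<omega>0)"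
            "\<exists>\<delta>2>0. \<forall>a\<in>{0, 1}. \<exists>i\<in>{1..n}. XT i \<omega>0 \<in> A a \<delta>2"
    \<comment> \<open>\<open>g l\<close> maps the tuple of unlabelled points to the labels found by the algorithm, under some
       measurable way of breaking the remaining ties\<close>
    and "\<forall>l. \<forall>x \<in> {1..l} \<rightarrow>\<^sub>E UNIV.
           algorithm_labels n (\<lambda>i. XT i \<omega>0) (\<lambda>i. YT i \<omega>0) l (h l) x (g l x)"
    and "\<forall>l. \<forall>i\<in>{1..l}. (\<lambda>x. g l x i) \<in> borel_measurable (PiM {1..l} (\<lambda>_. borel))"
  shows "(AE \<omega> in M. (\<lambda>l. error_rate l (g l (\<lambda>i\<in>{1..l}. Xs i \<omega>)) (\<lambda>i. Ys i \<omega>))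
            \<longlonglongrightarrow> measure M {\<omega> \<in> space M. bayes_rule \<eta> (X \<omega>) \<noteq> Y \<omega>}) \<and>
         (\<lambda>l. (\<integral>\<omega>. error_rate l (g l (\<lambda>i\<in>{1..l}. Xs i \<omega>)) (\<lambda>i. Ys i \<omega>) \<partial>M)
            - measure M {\<omega> \<in> space M. bayes_rule \<eta> (X \<omega>) \<noteq> Y \<omega>}) \<longlonglongrightarrow> 0"
proof -
  interpret prob_space M by fact
  note X_meas [measurable] = \<open>X \<in> borel_measurable M\<close>
    and Y_meas [measurable] = \<open>Y \<in> borel_measurable M\<close>
    and indep = \<open>indep_vars (\<lambda>_. borel \<Otimes>\<^sub>M borel) (\<lambda>i \<omega>. (Xs i \<omega>, Ys i \<omega>)) {1..}\<close>
    and ident = \<open>\<forall>i\<ge>1. distr M (borel \<Otimes>\<^sub>M borel) (\<lambda>\<omega>. (Xs i \<omega>, Ys i \<omega>))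
      = distr M (borel \<Otimes>\<^sub>M borel) (\<lambda>\<omega>. (X \<omega>, Y \<omega>))\<close>
    and train_sample = \<open>\<forall>i\<in>{1..n}. XT i \<in> borel_measurable N \<and> YT i \<in> borel_measurable N \<and>
      (\<forall>\<omega>\<in>space N. XT i \<omega> \<in> S \<and> YT i \<omega> \<in> {0, 1}) \<and>
      distr N (borel \<Otimes>\<^sub>M borel) (\<lambda>\<omega>. (XT i \<omega>, YT i \<omega>))
        = distr M (borel \<Otimes>\<^sub>M borel) (\<lambda>\<omega>. (X \<omega>, Y \<omega>))\<close>
    and labels = \<open>\<forall>l. \<forall>x \<in> {1..l} \<rightarrow>\<^sub>E UNIV.
      algorithm_labels n (\<lambda>i. XT i \<omega>0) (\<lambda>i. YT i \<omega>0) l (h l) x (g l x)\<close>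
    and g_meas = \<open>\<forall>l. \<forall>i\<in>{1..l}. (\<lambda>x. g l x i) \<in> borel_measurable (PiM {1..l} (\<lambda>_. borel))\<close>

  \<comment> \<open>Measurability and marginal laws\<close>
  have X_in_S: "X \<omega> \<in> S" if "\<omega> \<in> space M" for \<omega>
    using \<open>\<forall>\<omega>\<in>space M. X \<omega> \<in> S \<and> Y \<omega> \<in> {0, 1}\<close> that by blast
  have eta_meas [measurable]: "\<eta> \<in> borel_measurable borel"
    and eta_S: "\<And>x. x \<in> S \<Longrightarrow> \<eta> x \<in> {0..1}"
    using \<open>regression_function M X Y \<eta>\<close> by (simp_all add: regression_function_def S_def)
  have [measurable]: "S \<in> sets borel"
    unfolding S_def by (intro borel_closed closed_msupport) simp
  have I_meas [measurable]: "I a \<in> sets borel" for a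
    unfolding I_def class_region_def by (cases "a = 0") simp_all
  have A_meas [measurable]: "A a \<delta> \<in> sets borel" for a \<delta>
    unfolding A_def by (intro borel_closed closed_erosion)
  have in_I: "x \<in> I 0 \<union> I 1" if "x \<in> S" "\<eta> x \<noteq> 1 / 2" for x
    using eta_S[OF that(1)] that by (auto simp: I_def class_region_def)

  have XT_in_I: "XT i \<omega>0 \<in> I 0 \<union> I 1" if "i \<in> {1..n}" for i
  proof (rule in_I)
    show "XT i \<omega>0 \<in> S"
      using train_sample[THEN bspec, OF that] \<open>\<omega>0 \<in> space N\<close> by simp
    show "\<eta> (XT i \<omega>0) \<noteq> 1 / 2"
      using \<open>\<forall>i\<in>{1..n}. \<eta> (XT i \<omega>0) \<noteq> 1 / 2\<close> that by simp
  qed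

  have pair_meas: "(\<lambda>\<omega>. (Xs i \<omega>, Ys i \<omega>)) \<in> measurable M (borel \<Otimes>\<^sub>M borel)" if "i \<ge> 1" for i
    using indep that unfolding indep_vars_def by auto
  have Xs_meas [measurable]: "Xs i \<in> borel_measurable M" if "i \<ge> 1" for i
    using measurable_compose[OF pair_meas[OF that] measurable_fst] by simp
  have Ys_meas [measurable]: "Ys i \<in> borel_measurable M" if "i \<ge> 1" for i
    using measurable_compose[OF pair_meas[OF that] measurable_snd] by simp
  have distr_Xs: "distr M borel (Xs i) = distr M borel X" if "i \<ge> 1" for i
  proof -
    have "distr M borel (Xs i) = distr (distr M (borel \<Otimes>\<^sub>M borel) (\<lambda>\<omega>. (Xs i \<omega>, Ys i \<omega>))) borel fst"
      using pair_meas[OF that] by (subst distr_distr) (auto simp: comp_def)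
    also have "\<dots> = distr M borel X"
      using ident that by (simp add: distr_distr comp_def)
    finally show ?thesis .
  qed

  \<comment> \<open>Almost sure properties of the sample: no point on the decision boundary, no
    repetitions\<close>
  have "AE \<omega> in M. \<not> (X \<omega> \<in> S \<and> \<eta> (X \<omega>) = 1 / 2)"
    using H1 by (subst (asm) prob_eq_0) auto
  then have X_in_I: "AE \<omega> in M. X \<omega> \<in> I 0 \<union> I 1"
    using AE_space by eventually_elim (use X_in_S in_I in blast)
  have "AE \<omega> in M. Xs i \<omega> \<in> I 0 \<union> I 1" if "i \<ge> 1" for i
  proof -
    have "AE x in distr M borel X. x \<in> I 0 \<union> I 1"
      using X_in_I by (subst AE_distr_iff) auto
    then have "AE x in distr M borel (Xs i). x \<in> I 0 \<union> I 1"
      unfolding distr_Xs[OF that] .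
    then show ?thesis
      using that by (subst (asm) AE_distr_iff) auto
  qed
  then have Xs_in_I: "AE \<omega> in M. \<forall>i. i \<ge> 1 \<longrightarrow> Xs i \<omega> \<in> I 0 \<union> I 1"
    by (simp add: AE_all_countable)
  have Xs_inj: "AE \<omega> in M. inj_on (\<lambda>i. Xs i \<omega>) {1..}"
  proof -
    have "AE w in distr M borel (Xs i). w \<noteq> z" if "i \<ge> 1" for i z
      unfolding distr_Xs[OF that] by (rule distributed_lborel_diffuse[OF conjunct2[OF H6(1)]])
    then show ?thesis
      by (rule iid_distinct[OF indep, unfolded fst_conv])
  qed

  \<comment> \<open>Common threshold for the margins\<close>
  from H5 obtain \<delta>0 where \<delta>0: "\<delta>0 > 0"
    and core: "\<forall>a\<in>{0, 1}. \<forall>\<delta>. 0 < \<delta> \<and> \<delta> < \<delta>0 \<longrightarrow> connected (A a \<delta>) \<and>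
      (AE \<omega> in M. \<exists>l0. \<forall>l\<ge>l0.
        A a \<delta> \<subseteq> (\<Union>x \<in> (\<lambda>i. Xs i \<omega>) ` {1..l} \<inter> A a \<delta>. ball x (h l / 2)))"
    by (elim exE conjE)
  obtain \<delta>1 where \<delta>1: "\<delta>1 > 0"
    and gap: "\<And>\<delta>. 0 < \<delta> \<Longrightarrow> \<delta> < \<delta>1 \<Longrightarrow> \<exists>\<gamma>>0. \<forall>h'. 0 < h' \<and> h' < \<delta> \<longrightarrow>
      (\<forall>a \<in> A 0 \<delta> \<union> A 1 \<delta>. \<forall>b \<in> B 0 h' \<union> B 1 h'. f a - f b > \<gamma>)"
    using H6(2) by blast
  obtain \<delta>2 where \<delta>2: "\<delta>2 > 0"
    and train: "\<And>a. a \<in> {0, 1} \<Longrightarrow> \<exists>i\<in>{1..n}. XT i \<omega>0 \<in> A a \<delta>2"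
    using H8(2) by blast
  \<comment> \<open>Below \<open>d\<close> the hypotheses H5, H6 and H8 all apply; the training
    points of H8 stay in the core because erosions grow as the margin shrinks.\<close>
  define d where "d = Min {\<delta>0, \<delta>1, \<delta>2}"
  have d: "d > 0" "d \<le> \<delta>0" "d \<le> \<delta>1" "d \<le> \<delta>2"
    using \<delta>0 \<delta>1 \<delta>2 by (simp_all add: d_def)
  have A_mono: "A a \<delta>' \<subseteq> A a \<delta>" if "\<delta> \<le> \<delta>'" for a \<delta> \<delta>'
    using that by (simp add: A_def erosion_antimono)
  define G where "G l \<omega> = g l (\<lambda>i\<in>{1..l}. Xs i \<omega>)" for l \<omega>

  \<comment> \<open>Almost surely, core points eventually receive the Bayes label\<close>
  have correct: "AE \<omega> in M. \<forall>\<^sub>F l in sequentially. \<forall>i\<in>{1..l}.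
      Xs i \<omega> \<in> A 0 \<delta> \<union> A 1 \<delta> \<longrightarrow> G l \<omega> i = bayes_rule \<eta> (Xs i \<omega>)"
    if \<delta>: "0 < \<delta>" "\<delta> < d" for \<delta>
  proof -
    obtain \<gamma> where \<gamma>: "\<gamma> > 0" and gap_\<gamma>: "\<And>h' a b. 0 < h' \<Longrightarrow> h' < \<delta> \<Longrightarrow>
        a \<in> A 0 \<delta> \<union> A 1 \<delta> \<Longrightarrow> b \<in> B 0 h' \<union> B 1 h' \<Longrightarrow> f a - f b > \<gamma>"
      using gap[of \<delta>] \<delta> d by auto
    \<comment> \<open>The tolerance is half the gap because two density estimates will be
      compared.\<close>
    have "AE \<omega> in M. \<exists>l0. \<forall>l\<ge>l0.
        (SUP u\<in>S. ereal \<bar>density_estimate l (h l) (\<lambda>i. Xs i \<omega>) u - f u\<bar>) < ereal (\<gamma> / 2)"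
      using H7 \<gamma> by simp
    moreover have "AE \<omega> in M. \<exists>l0. \<forall>l\<ge>l0.
        A a \<delta> \<subseteq> (\<Union>x \<in> (\<lambda>i. Xs i \<omega>) ` {1..l} \<inter> A a \<delta>. ball x (h l / 2))" if "a \<in> {0, 1}" for a
      using core[THEN bspec, OF that, THEN spec, of \<delta>] \<delta> d by linarith
    from this[of 0] this[of 1] have "AE \<omega> in M. \<exists>l0. \<forall>l\<ge>l0.
        A 0 \<delta> \<subseteq> (\<Union>x \<in> (\<lambda>i. Xs i \<omega>) ` {1..l} \<inter> A 0 \<delta>. ball x (h l / 2))"
      "AE \<omega> in M. \<exists>l0. \<forall>l\<ge>l0.
        A 1 \<delta> \<subseteq> (\<Union>x \<in> (\<lambda>i. Xs i \<omega>) ` {1..l} \<inter> A 1 \<delta>. ball x (h l / 2))"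
      by simp_all
    ultimately show ?thesis
      using Xs_in_I Xs_inj
    proof eventually_elim
      case (elim \<omega>)
      have "\<forall>\<^sub>F l in sequentially. h l < \<delta>"
        using order_tendstoD(2)[OF \<open>h \<longlonglongrightarrow> 0\<close> \<delta>(1)] .
      with elim(1,2,3)[folded eventually_sequentially] show ?case
      proof eventually_elim
        case (elim l)
        show ?case
        proof (intro ballI impI)
          fix i assume i: "i \<in> {1..l}" "Xs i \<omega> \<in> A 0 \<delta> \<union> A 1 \<delta>"
          \<comment> \<open>\<open>g l\<close> acts on tuples restricted to \<open>{1..l}\<close>;
            facts about the sample are transferred to \<open>x\<close> by agreement on these
            indices.\<close>
          define x where "x = (\<lambda>i\<in>{1..l}. Xs i \<omega>)"
          have x: "x k = Xs k \<omega>" if "k \<in> {1..l}" for k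
            using that by (simp add: x_def)
          have img: "x ` {1..l} = (\<lambda>i. Xs i \<omega>) ` {1..l}"
            using x by (intro image_cong) auto
          have "G l \<omega> i = bayes_rule \<eta> (x i)"
            unfolding G_def x_def[symmetric]
          proof (rule core_labels_correct[where S = S and \<delta> = \<delta> and f = f and \<gamma> = \<gamma>
                and h = "h l" and n = n and l = l])
            show "XT k \<omega>0 \<in> class_region S \<eta> 0 \<union> class_region S \<eta> 1" if "k \<in> {1..n}" for k
              using XT_in_I[OF that] by (simp add: I_def)
            show "YT k \<omega>0 = bayes_rule \<eta> (XT k \<omega>0)" if "k \<in> {1..n}" for k
              using H8(1) that by blast
            show "\<exists>k\<in>{1..n}. XT k \<omega>0 \<in> erosion (class_region S \<eta> a) \<delta>" if "a \<in> {0, 1}" for a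
            proof -
              have "A a \<delta>2 \<subseteq> A a \<delta>"
                using \<delta> d by (intro A_mono) simp
              with train[OF that] show ?thesis
                unfolding A_def I_def by blast
            qed
            show "x k \<in> class_region S \<eta> 0 \<union> class_region S \<eta> 1" if "k \<in> {1..l}" for k
              using \<open>\<forall>i. i \<ge> 1 \<longrightarrow> Xs i \<omega> \<in> I 0 \<union> I 1\<close> that x[OF that] by (simp add: I_def)
            have "inj_on (\<lambda>i. Xs i \<omega>) {1..l}"
              using \<open>inj_on (\<lambda>i. Xs i \<omega>) {1..}\<close> by (rule inj_on_subset) auto
            then show "inj_on x {1..l}"
              using inj_on_cong[of "{1..l}" x "\<lambda>i. Xs i \<omega>"] x by simp
            show "0 < h l" "h l \<le> \<delta>"
              using \<open>\<forall>l. h l > 0\<close> \<open>h l < \<delta>\<close> by auto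
            fix a :: nat assume a: "a \<in> {0, 1}"
            show "connected (erosion (class_region S \<eta> a) \<delta>)"
              using core[THEN bspec, OF a, THEN spec, of \<delta>] \<delta> d by (simp add: A_def I_def)
            show "erosion (class_region S \<eta> a) \<delta>
                \<subseteq> (\<Union>z \<in> x ` {1..l} \<inter> erosion (class_region S \<eta> a) \<delta>. ball z (h l / 2))"
              using elim(2,3) a unfolding img A_def I_def by auto
          next
            fix z assume "z \<in> S"
            then have "ereal \<bar>density_estimate l (h l) (\<lambda>i. Xs i \<omega>) z - f z\<bar> < ereal (\<gamma> / 2)"
              by (intro le_less_trans[OF SUP_upper elim(1)])
            moreover have "density_estimate l (h l) x z = density_estimate l (h l) (\<lambda>i. Xs i \<omega>) z"
            proof -
              have "(\<Sum>i=1..l. indicator (ball z (h l)) (x i))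
                  = (\<Sum>i=1..l. indicator (ball z (h l)) (Xs i \<omega>) :: real)"
                by (intro sum.cong) (simp_all add: x)
              then show ?thesis
                by (simp add: density_estimate_def)
            qed
            ultimately show "\<bar>density_estimate l (h l) x z - f z\<bar> < \<gamma> / 2"
              by simp
          next
            fix a b
            assume "a \<in> erosion (class_region S \<eta> 0) \<delta> \<union> erosion (class_region S \<eta> 1) \<delta>"
              "b \<in> border_region S \<eta> 0 (h l) \<union> border_region S \<eta> 1 (h l)"
            then show "f a - f b > \<gamma>"
              using gap_\<gamma>[of "h l" a b] \<open>\<forall>l. h l > 0\<close> \<open>h l < \<delta>\<close> by (simp add: A_def B_def I_def)
          next
            show "algorithm_labels n (\<lambda>i. XT i \<omega>0) (\<lambda>i. YT i \<omega>0) l (h l) x (g l x)"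
              using labels by (simp add: x_def)
            show "i \<in> {1..l}" by fact
            show "x i \<in> erosion (class_region S \<eta> 0) \<delta> \<union> erosion (class_region S \<eta> 1) \<delta>"
              using i x[OF i(1)] by (simp add: A_def I_def)
          qed
          then show "G l \<omega> i = bayes_rule \<eta> (Xs i \<omega>)"
            using x[OF i(1)] by simp
        qed
      qed
    qed
  qed

  \<comment> \<open>The probability of non-core points vanishes\<close>
  define \<delta> where "\<delta> m = d / (real m + 2)" for m
  \<comment> \<open>The summand 2 in the denominator keeps the margin strictly below
    \<open>d\<close> even at \<open>m = 0\<close>.\<close>
  have \<delta>: "0 < \<delta> m" "\<delta> m < d" for m
    using d(1) divide_strict_left_mono[of 1 "real m + 2" d] by (simp_all add: \<delta>_def)
  have \<delta>_lim: "\<delta> \<longlonglongrightarrow> 0"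
    unfolding \<delta>_def by real_asymp
  have \<delta>_antimono: "\<delta> m' \<le> \<delta> m" if "m \<le> m'" for m m'
    using d that by (simp add: \<delta>_def frac_le)
  define bad where "bad m = - (A 0 (\<delta> m) \<union> A 1 (\<delta> m))" for m
  have [measurable]: "bad m \<in> sets borel" for m
    unfolding bad_def by measurable
  have bad_lim: "(\<lambda>m. prob {\<omega> \<in> space M. X \<omega> \<in> bad m}) \<longlonglongrightarrow> 0"
  proof -
    have "(\<lambda>m. prob {\<omega> \<in> space M. X \<omega> \<in> bad m}) \<longlonglongrightarrow> prob (\<Inter>m. {\<omega> \<in> space M. X \<omega> \<in> bad m})"
    proof (rule finite_Lim_measure_decseq)
      show "decseq (\<lambda>m. {\<omega> \<in> space M. X \<omega> \<in> bad m})"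
        unfolding decseq_def bad_def using A_mono[OF \<delta>_antimono] by blast
    qed auto
    moreover have "prob (\<Inter>m. {\<omega> \<in> space M. X \<omega> \<in> bad m}) = 0"
    proof -
      \<comment> \<open>By \<open>eta_version\<close>, almost surely \<open>X\<close> lies in the
        interior of its class. A ball around it then fits in the class, so it is a core point once
        \<open>\<delta> m\<close> is below the radius.\<close>
      have not_edge: "AE \<omega> in M. X \<omega> \<notin> I a - interior (I a)" if "a \<in> {0, 1}" for a
      proof -
        have [measurable]: "I a - interior (I a) \<in> sets borel"
          by (intro sets.Diff I_meas) auto
        have "{\<omega> \<in> space M. X \<omega> \<in> I a - interior (I a)} \<in> events"
          by measurable
        from prob_eq_0[OF this] have "AE \<omega> in M. \<omega> \<notin> {\<omega> \<in> space M. X \<omega> \<in> I a - interior (I a)}"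
          using eta_version[THEN bspec, OF that] by (rule iffD1)
        then show ?thesis
          using AE_space by eventually_elim blast
      qed
      have "AE \<omega> in M. \<omega> \<notin> (\<Inter>m. {\<omega> \<in> space M. X \<omega> \<in> bad m})"
        using X_in_I not_edge[of 0, simplified] not_edge[of 1, simplified]
      proof eventually_elim
        case (elim \<omega>)
        then obtain a where a: "a \<in> {0, 1}" "X \<omega> \<in> interior (I a)"
          by auto
        then obtain e where e: "e > 0" "ball (X \<omega>) e \<subseteq> I a"
          by (auto simp: mem_interior)
        obtain m where "\<delta> m < e"
          using order_tendstoD(2)[OF \<delta>_lim e(1)] by (auto simp: eventually_sequentially)
        then have "X \<omega> \<in> A a (\<delta> m)"
          using e(2) unfolding A_def erosion_def by auto
        then show ?case
          using a(1) by (auto simp: bad_def)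
      qed
      then show ?thesis
        by (subst prob_eq_0) auto
    qed
    ultimately show ?thesis by simp
  qed

  \<comment> \<open>Almost sure convergence of the error rate\<close>
  define L where "L = prob {\<omega> \<in> space M. bayes_rule \<eta> (X \<omega>) \<noteq> Y \<omega>}"
  define E where "E l \<omega> = error_rate l (G l \<omega>) (\<lambda>i. Ys i \<omega>)" for l \<omega>
  have E_lim: "AE \<omega> in M. (\<lambda>l. E l \<omega>) \<longlonglongrightarrow> L"
  proof -
    \<comment> \<open>This is used for the misclassified pairs, giving the Bayes error, and for
      \<open>bad m \<times> UNIV\<close>, giving the frequency of non-core points.\<close>
    have frequency: "AE \<omega> in M. (\<lambda>l. (1 / real l) * (\<Sum>i=1..l. of_bool ((Xs i \<omega>, Ys i \<omega>) \<in> C)))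
        \<longlonglongrightarrow> prob {\<omega> \<in> space M. (X \<omega>, Y \<omega>) \<in> C}" if "C \<in> sets (borel \<Otimes>\<^sub>M borel)" for C
      using iid_frequency_tendsto[OF indep, of "\<lambda>\<omega>. (X \<omega>, Y \<omega>)" C] ident that by simp
    have "{(x, y). bayes_rule \<eta> x \<noteq> y} \<in> sets (borel \<Otimes>\<^sub>M borel)"
    proof -
      have [measurable]: "bayes_rule \<eta> \<in> borel_measurable borel"
        unfolding bayes_rule_def by measurable
      have "{p \<in> space (borel \<Otimes>\<^sub>M borel). bayes_rule \<eta> (fst p) \<noteq> snd p} \<in> sets (borel \<Otimes>\<^sub>M borel)"
        by measurable
      then show ?thesis
        by (simp add: space_pair_measure case_prod_unfold)
    qed
    from frequency[OF this] have "AE \<omega> in M.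
        (\<lambda>l. error_rate l (\<lambda>i. bayes_rule \<eta> (Xs i \<omega>)) (\<lambda>i. Ys i \<omega>)) \<longlonglongrightarrow> L"
      by (simp add: L_def error_rate_def)
    moreover have "AE \<omega> in M. \<forall>m. (\<lambda>l. (1 / real l) * (\<Sum>i=1..l. of_bool (Xs i \<omega> \<in> bad m)))
        \<longlonglongrightarrow> prob {\<omega> \<in> space M. X \<omega> \<in> bad m}"
      unfolding AE_all_countable using frequency[of "bad _ \<times> UNIV"] by auto
    \<comment> \<open>Restricting the margins to the sequence \<open>\<delta> m\<close> leaves only
      countably many null sets to unite.\<close>
    moreover have "AE \<omega> in M. \<forall>m. \<forall>\<^sub>F l in sequentially. \<forall>i\<in>{1..l}.
        Xs i \<omega> \<in> A 0 (\<delta> m) \<union> A 1 (\<delta> m) \<longrightarrow> G l \<omega> i = bayes_rule \<eta> (Xs i \<omega>)"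
      unfolding AE_all_countable using correct \<delta> by blast
    ultimately show ?thesis
    proof eventually_elim
      case (elim \<omega>)
      show ?case
      proof (rule tendsto_via_approximations[OF _ _ bad_lim elim(1)])
        fix m
        show "(\<lambda>l. (1 / real l) * (\<Sum>i=1..l. of_bool (Xs i \<omega> \<in> bad m)))
            \<longlonglongrightarrow> prob {\<omega> \<in> space M. X \<omega> \<in> bad m}"
          using elim(2) by blast
        from elim(3) have "\<forall>\<^sub>F l in sequentially. \<forall>i\<in>{1..l}.
            Xs i \<omega> \<in> A 0 (\<delta> m) \<union> A 1 (\<delta> m) \<longrightarrow> G l \<omega> i = bayes_rule \<eta> (Xs i \<omega>)"
          by blast
        then show "\<forall>\<^sub>F l in sequentially.
            \<bar>E l \<omega> - error_rate l (\<lambda>i. bayes_rule \<eta> (Xs i \<omega>)) (\<lambda>i. Ys i \<omega>)\<bar>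
              \<le> (1 / real l) * (\<Sum>i=1..l. of_bool (Xs i \<omega> \<in> bad m))"
        proof eventually_elim
          case (elim l)
          show ?case
            unfolding E_def
            using error_rate_diff_le[of l "{i. Xs i \<omega> \<in> bad m}" "G l \<omega>" "\<lambda>i. bayes_rule \<eta> (Xs i \<omega>)"]
              elim by (simp add: bad_def)
        qed
      qed
    qed
  qed

  \<comment> \<open>Convergence of the expectation, by dominated convergence with bound 1\<close>
  have E_meas: "E l \<in> borel_measurable M" for l
  proof -
    have [measurable]: "(\<lambda>\<omega>. G l \<omega> i) \<in> borel_measurable M" if "i \<in> {1..l}" for i
    proof -
      have "(\<lambda>\<omega>. \<lambda>i\<in>{1..l}. Xs i \<omega>) \<in> measurable M (PiM {1..l} (\<lambda>_. borel))"
        by (intro measurable_restrict) auto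
      moreover have "(\<lambda>x. g l x i) \<in> borel_measurable (PiM {1..l} (\<lambda>_. borel))"
        using g_meas that by blast
      ultimately show ?thesis
        unfolding G_def by (rule measurable_compose)
    qed
    show ?thesis
      unfolding E_def[abs_def] error_rate_def by measurable
  qed
  have "(\<lambda>l. expectation (E l)) \<longlonglongrightarrow> expectation (\<lambda>_. L)"
  proof (rule integral_dominated_convergence[where w = "\<lambda>_. 1"])
    show "AE \<omega> in M. norm (E l \<omega>) \<le> 1" for l
      using error_rate_bounds[of l] by (auto simp: E_def)
  qed (use E_meas E_lim in auto)
  then have "(\<lambda>l. expectation (E l) - L) \<longlonglongrightarrow> 0"
    by (simp add: prob_space LIM_zero)
  with E_lim show ?thesis
    by (simp add: E_def[abs_def] G_def L_def)
qed

end
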